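(* Let $f(x),g(x)\in\mathbb{Z}[x]$ be monic polynomials and $p$ a prime such that $g(x)$ is irreducible modulo $p$. Suppose $f(x)\in\langle p,g(x)^2\rangle$. Then $$f(x)\in\langle p,g(x)\rangle^2\iff f(x^p)\in\langle p,g(x)\rangle^2.$$
   Context: For $S\subset\mathbb{Z}[x]$, $\langle S\rangle$ denotes the ideal of $\mathbb{Z}[x]$ generated by $S$. *)

theory Defs
  imports
    "HOL-Algebra.Algebraic_Closure_Type"
    "HOL-Algebra.Ideal_Product"
    "Berlekamp_Zassenhaus.Poly_Mod"
begin

text \<open>The carrier-based presentation of \<open>\<int>[x]\<close>, so that the ideal generated by a set and the
  product of two ideals are those of HOL-Algebra.\<close>

abbreviation Zx :: "int poly ring"
  where "Zx \<equiv> ring_of_type_algebra"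

end

theory Submission
  imports Defs
begin

text \<open>Put \<open>I = \<langle>p, g\<rangle>\<close> and write \<open>f = a p + b g\<^sup>2\<close>. Cancelling \<open>p\<close>, which does not divide \<open>g\<close>, gives
  \<open>f \<in> I\<^sup>2 \<longleftrightarrow> a p \<in> I\<^sup>2 \<longleftrightarrow> a \<in> I\<close>. Since \<open>h(x\<^sup>p) \<equiv> h(x)\<^sup>p\<close> modulo \<open>p\<close>, we have \<open>g(x\<^sup>p) \<in> I\<close>, and the
  same cancellation gives \<open>f(x\<^sup>p) \<in> I\<^sup>2 \<longleftrightarrow> a(x\<^sup>p) \<in> I \<longleftrightarrow> a\<^sup>p \<in> I\<close>. As \<open>I\<close> is prime, this is again
  \<open>a \<in> I\<close>.\<close>

section \<open>Explicit form of two-generated ideals and of their squares\<close>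

lemma ring_of_type_algebra_simps:
  "carrier (ring_of_type_algebra :: 'a :: comm_ring_1 ring) = UNIV"
  "x \<otimes>\<^bsub>ring_of_type_algebra\<^esub> y = x * (y :: 'a :: comm_ring_1)"
  "x \<oplus>\<^bsub>ring_of_type_algebra\<^esub> y = x + (y :: 'a :: comm_ring_1)"
  "\<zero>\<^bsub>ring_of_type_algebra\<^esub> = (0 :: 'a :: comm_ring_1)"
  by (simp_all add: ring_of_type_algebra_def)

text \<open>Closure under negation comes for free, since \<open>-x = (-1) * x\<close>.\<close>

lemma ideal_ring_of_type_algebraI:
  fixes I :: "'a :: comm_ring_1 set"
  assumes "0 \<in> I" "\<And>x y. x \<in> I \<Longrightarrow> y \<in> I \<Longrightarrow> x + y \<in> I" "\<And>x r. x \<in> I \<Longrightarrow> r * x \<in> I"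
  shows "ideal I ring_of_type_algebra"
proof -
  interpret R: ring "ring_of_type_algebra :: 'a ring"
    by (rule ring_from_type_algebra)
  have *: "\<ominus>\<^bsub>ring_of_type_algebra\<^esub> x = - x" for x :: 'a
    by (rule R.minus_equality) (simp_all add: ring_of_type_algebra_simps)
  show ?thesis
  proof (rule idealI)
    show "subgroup I (add_monoid ring_of_type_algebra)"
      using assms(1,2) assms(3)[of _ "-1"]
      by (intro R.add.subgroupI)
         (auto simp: ring_of_type_algebra_simps * simp flip: a_inv_def)
  qed (use assms(3) in \<open>auto simp: ring_of_type_algebra_simps mult.commute intro: R.ring_axioms\<close>)
qed

lemma ideal_ring_of_type_algebraD:
  fixes I :: "'a :: comm_ring_1 set"
  assumes "ideal I ring_of_type_algebra"
  shows "x \<in> I \<Longrightarrow> y \<in> I \<Longrightarrow> x + y \<in> I" "x \<in> I \<Longrightarrow> r * x \<in> I"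
  using additive_subgroup.a_closed[OF ideal.axioms(1)[OF assms]]
    ideal.I_l_closed[OF assms]
  by (auto simp: ring_of_type_algebra_simps)

lemma Idl_pair:
  fixes a b :: "'a :: comm_ring_1"
  shows "Idl\<^bsub>ring_of_type_algebra\<^esub> {a, b} = {u * a + v * b | u v. True}" (is "_ = ?I")
proof
  interpret R: ring "ring_of_type_algebra :: 'a ring"
    by (rule ring_from_type_algebra)
  have "ideal ?I ring_of_type_algebra"
  proof (rule ideal_ring_of_type_algebraI)
    have "0 = 0 * a + 0 * b" by simp
    then show "0 \<in> ?I" by blast
  next
    fix x y assume "x \<in> ?I" "y \<in> ?I"
    then obtain u v u' v' where "x = u * a + v * b" "y = u' * a + v' * b" by auto
    then have "x + y = (u + u') * a + (v + v') * b" by (simp add: algebra_simps)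
    then show "x + y \<in> ?I" by blast
  next
    fix x r assume "x \<in> ?I"
    then obtain u v where "x = u * a + v * b" by auto
    then have "r * x = (r * u) * a + (r * v) * b" by (simp add: algebra_simps)
    then show "r * x \<in> ?I" by blast
  qed
  moreover have "a = 1 * a + 0 * b" "b = 0 * a + 1 * b" by simp_all
  then have "{a, b} \<subseteq> ?I" by blast
  ultimately show "Idl\<^bsub>ring_of_type_algebra\<^esub> {a, b} \<subseteq> ?I"
    by (rule R.genideal_minimal)
next
  interpret R: ring "ring_of_type_algebra :: 'a ring"
    by (rule ring_from_type_algebra)
  have "ideal (Idl\<^bsub>ring_of_type_algebra\<^esub> {a, b}) ring_of_type_algebra"
    by (rule R.genideal_ideal) (simp add: ring_of_type_algebra_simps)
  moreover have "{a, b} \<subseteq> Idl\<^bsub>ring_of_type_algebra\<^esub> {a, b}"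
    by (rule R.genideal_self) (simp add: ring_of_type_algebra_simps)
  ultimately show "?I \<subseteq> Idl\<^bsub>ring_of_type_algebra\<^esub> {a, b}"
    by (auto intro!: ideal_ring_of_type_algebraD)
qed

text \<open>Expanding \<open>(u * a + v * b) * (u' * a + v' * b)\<close> merges the two mixed terms
  into one coefficient, and the resulting form is stable under sums.\<close>

lemma Idl_pair_square:
  fixes a b :: "'a :: comm_ring_1"
  defines "I \<equiv> Idl\<^bsub>ring_of_type_algebra\<^esub> {a, b}"
  shows "I \<cdot>\<^bsub>ring_of_type_algebra\<^esub> I
    = {u * a * a + v * a * b + w * b * b | u v w. True}" (is "_ = ?J")
proof
  show "I \<cdot>\<^bsub>ring_of_type_algebra\<^esub> I \<subseteq> ?J"
  proof
    fix x assume "x \<in> I \<cdot>\<^bsub>ring_of_type_algebra\<^esub> I"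
    then show "x \<in> ?J"
    proof induction
      case (prod i j)
      then obtain u v u' v' where "i = u * a + v * b" "j = u' * a + v' * b"
        by (auto simp: I_def Idl_pair)
      then have "i * j = (u * u') * a * a + (u * v' + v * u') * a * b + (v * v') * b * b"
        by (simp add: algebra_simps)
      then show ?case unfolding ring_of_type_algebra_simps by blast
    next
      case (sum s t)
      then obtain u v w u' v' w' where
        "s = u * a * a + v * a * b + w * b * b" "t = u' * a * a + v' * a * b + w' * b * b"
        by auto
      then have "s + t = (u + u') * a * a + (v + v') * a * b + (w + w') * b * b"
        by (simp add: algebra_simps)
      then show ?case unfolding ring_of_type_algebra_simps by blast
    qed
  qed
next
  have "x * a \<in> I" "x * b \<in> I" for x
  proof -
    have "x * a = x * a + 0 * b" "x * b = 0 * a + x * b" by simp_all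
    then show "x * a \<in> I" "x * b \<in> I" unfolding I_def Idl_pair by blast+
  qed
  from this this[of 1] have
    "u * a * a \<in> I \<cdot>\<^bsub>ring_of_type_algebra\<^esub> I"
    "v * a * b \<in> I \<cdot>\<^bsub>ring_of_type_algebra\<^esub> I"
    "w * b * b \<in> I \<cdot>\<^bsub>ring_of_type_algebra\<^esub> I" for u v w
    using ideal_prod.prod[of _ I _ I ring_of_type_algebra]
    by (simp_all add: ring_of_type_algebra_simps)
  then show "?J \<subseteq> I \<cdot>\<^bsub>ring_of_type_algebra\<^esub> I"
    using ideal_prod.sum[of _ ring_of_type_algebra I I]
    by (auto simp: ring_of_type_algebra_simps)
qed

section \<open>The Frobenius congruence modulo a prime\<close>

lemma prime_dvd_add_power_diff:
  fixes x y :: "'a :: comm_ring_1"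
  assumes "prime p"
  shows "of_nat p dvd (x + y) ^ p - (x ^ p + y ^ p)"
proof -
  have "p > 0" using assms by (rule prime_gt_0_nat)
  let ?t = "\<lambda>k. of_nat (p choose k) * x ^ k * y ^ (p - k)"
  have "{..p} = insert 0 (insert p {0<..<p})" using \<open>p > 0\<close> by auto
  then have "(x + y) ^ p - (x ^ p + y ^ p) = sum ?t {0<..<p}"
    using \<open>p > 0\<close> by (simp add: binomial_ring)
  also have "of_nat p dvd \<dots>"
  proof (rule dvd_sum)
    fix k assume "k \<in> {0<..<p}"
    then have "p dvd p choose k" using assms by (intro dvd_choose_prime) auto
    then have "(of_nat p :: 'a) dvd of_nat (p choose k)" by (metis dvd_def of_nat_mult)
    then show "of_nat p dvd ?t k" by (intro dvd_mult2)
  qed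
  finally show ?thesis .
qed

text \<open>Fermat's little theorem, reached from \<open>0\<close> in both directions: the binomial
  congruence with second summand \<open>1\<close> passes from an integer to its neighbour.\<close>

lemma prime_dvd_int_power_diff:
  fixes a :: int
  assumes "prime p"
  shows "int p dvd a ^ p - a"
proof (induction a rule: int_induct[where k = 0])
  case base
  show ?case using assms by (simp add: zero_power prime_gt_0_nat)
next
  case (step1 i)
  have "(i + 1) ^ p - (i + 1) = ((i + 1) ^ p - (i ^ p + 1 ^ p)) + (i ^ p - i)" by simp
  with prime_dvd_add_power_diff[OF assms, of i 1] step1(2) show ?case
    by (metis dvd_add)
next
  case (step2 i)
  have "(i - 1) ^ p - (i - 1) = (i ^ p - i) - ((i - 1 + 1) ^ p - ((i - 1) ^ p + 1 ^ p))" by simp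
  with prime_dvd_add_power_diff[OF assms, of "i - 1" 1] step2(2) show ?case
    by (metis dvd_diff)
qed

text \<open>Induction on the coefficients: Fermat handles the constant term, the binomial congruence
  the sum, and the induction hypothesis times \<open>z ^ p\<close> the rest.\<close>

lemma prime_dvd_pcompose_monom_diff:
  fixes f :: "int poly"
  assumes "prime p"
  shows "of_nat p dvd pcompose f (monom 1 p) - f ^ p"
proof (induction f)
  case 0
  show ?case using assms by (simp add: zero_power prime_gt_0_nat)
next
  case (pCons a f)
  define z :: "int poly" where "z = monom 1 1"
  have z: "pCons a f = [:a:] + z * f" "monom 1 p = z ^ p"
    by (simp_all add: z_def monom_altdef)
  have "of_nat p dvd [:a:] ^ p - [:a:]"
    using prime_dvd_int_power_diff[OF assms, of a]
    by (simp add: of_nat_poly poly_const_pow const_poly_dvd)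
  moreover have "of_nat p dvd ([:a:] + z * f) ^ p - ([:a:] ^ p + (z * f) ^ p)"
    by (rule prime_dvd_add_power_diff[OF assms])
  moreover have "of_nat p dvd z ^ p * (pcompose f (z ^ p) - f ^ p)"
    using pCons(2) unfolding z(2) by (rule dvd_mult)
  \<comment> \<open>The three multiples of \<open>p\<close> are combined so that
    \<open>[:a:] ^ p\<close> and \<open>(z * f) ^ p\<close> cancel.\<close>
  ultimately have "of_nat p dvd z ^ p * (pcompose f (z ^ p) - f ^ p) - ([:a:] ^ p - [:a:])
      - (([:a:] + z * f) ^ p - ([:a:] ^ p + (z * f) ^ p))"
    by (metis dvd_diff)
  also have "\<dots> = pcompose (pCons a f) (z ^ p) - ([:a:] + z * f) ^ p"
    by (simp add: pcompose_pCons power_mult_distrib algebra_simps)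
  finally show ?case unfolding z .
qed

section \<open>Divisibility modulo \<open>m\<close>, and primality of irreducible polynomials
  there\<close>

lemma (in poly_mod) eq_m_iff_dvd: "f =m g \<longleftrightarrow> [:m:] dvd f - g"
  by (simp add: poly_eq_iff Mp_coeff M_def mod_eq_dvd_iff const_poly_dvd_iff)

lemma (in poly_mod) dvdm_iff_mem_Idl: "g dvdm a \<longleftrightarrow> a \<in> Idl\<^bsub>Zx\<^esub> {[:m:], g}"
  unfolding div_mod_iff_dvdm Idl_pair by (auto simp: add.commute)

text \<open>The leading coefficient of the reduction of \<open>r\<close> is invertible modulo
  \<open>m\<close>; scaling by an inverse and correcting by multiples of \<open>m\<close> yields a
  monic integer polynomial.\<close>

lemma (in poly_mod) monic_associate_mod_prime:
  assumes "prime m" "\<not> [:m:] dvd r"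
  obtains c t where "monic (smult c r + [:m:] * t)" "degree (smult c r + [:m:] * t) \<le> degree r"
proof -
  define n where "n = degree (Mp r)"
  have "Mp r \<noteq> 0" using assms(2) eq_m_iff_dvd[of r 0] by simp
  define l where "l = M (coeff r n)"
  have "l \<noteq> 0" "M l = l"
    using \<open>Mp r \<noteq> 0\<close> unfolding l_def n_def by (metis Mp_coeff leading_coeff_neq_0, simp)
  then have "\<not> m dvd l" by (metis M_def mod_eq_0_iff_dvd)
  then have "gcd m l = 1"
    using assms(1) by (intro coprime_imp_gcd_eq_1 prime_elem_imp_coprime prime_imp_prime_elem)
  then obtain u c where uc: "u * m + c * l = 1"
    using bezout_int[of m l] by auto
  \<comment> \<open>\<open>c * l\<close> is only congruent to 1; the added monomial, a multiple of
    \<open>m\<close>, makes the top coefficient exactly 1.\<close>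
  define s where "s = smult c (Mp r) + monom (1 - c * l) n"
  have "coeff s n = 1" by (simp add: s_def Mp_coeff l_def)
  moreover have "degree s \<le> n"
    unfolding s_def n_def by (intro degree_add_le degree_smult_le degree_monom_le)
  ultimately have s: "monic s" "degree s = n"
    using le_degree[of s n] by auto
  have "1 - c * l = u * m" using uc by simp
  then have "[:m:] dvd monom (1 - c * l) n"
    by (simp add: const_poly_dvd_iff)
  moreover have "[:m:] dvd [:c:] * (Mp r - r)"
    using eq_m_iff_dvd[of "Mp r" r] by (intro dvd_mult) simp
  ultimately have "[:m:] dvd [:c:] * (Mp r - r) + monom (1 - c * l) n"
    by (rule dvd_add[rotated])
  also have "\<dots> = s - smult c r" by (simp add: s_def smult_diff_right)
  finally obtain t where "s - smult c r = [:m:] * t" by (rule dvdE)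
  then have "s = smult c r + [:m:] * t" by (simp add: algebra_simps)
  with s that[of c t] show ?thesis
    unfolding n_def using degree_m_le[of r] by simp
qed

text \<open>Mirrors the fact that polynomials over a field form a principal ideal domain: a monic
  element of least degree leaves remainders that minimality forces to vanish modulo
  \<open>m\<close>.\<close>

lemma (in poly_mod) ideal_principal_mod_prime:
  assumes "prime m" "ideal K Zx" "[:m:] \<in> K"
  obtains d where "d \<in> K" "\<And>x. x \<in> K \<Longrightarrow> d dvdm x"
proof (cases "\<exists>x\<in>K. \<not> [:m:] dvd x")
  \<comment> \<open>All of \<open>K\<close> vanishes modulo \<open>m\<close>, so
    \<open>[:m:]\<close> itself serves as generator.\<close>
  case False
  show ?thesis
  proof (rule that[OF assms(3)])
    fix x assume "x \<in> K"
    with False show "[:m:] dvdm x" by (auto intro: dvd_imp_dvdm)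
  qed
next
  case True
  note K = ideal_ring_of_type_algebraD[OF assms(2)]
  have monic: "\<exists>d. d \<in> K \<and> monic d \<and> degree d \<le> degree x"
    if x: "x \<in> K" "\<not> [:m:] dvd x" for x
  proof -
    obtain c t where "monic (smult c x + [:m:] * t)" "degree (smult c x + [:m:] * t) \<le> degree x"
      by (rule monic_associate_mod_prime[OF assms(1) x(2)])
    moreover have "smult c x + [:m:] * t \<in> K"
      using K(1)[OF K(2)[OF x(1), of "[:c:]"] K(2)[OF assms(3), of t]] by (simp add: mult.commute)
    ultimately show ?thesis by blast
  qed
  then obtain d where d: "d \<in> K" "monic d"
    and min: "\<And>e. e \<in> K \<Longrightarrow> monic e \<Longrightarrow> degree d \<le> degree e"
    using True ex_has_least_nat[of "\<lambda>d. d \<in> K \<and> monic d" _ degree] by metis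
  show ?thesis
  proof (rule that[OF d(1)])
    fix x assume "x \<in> K"
    have "d \<noteq> 0" using d(2) by auto
    obtain q r where "pseudo_divmod x d = (q, r)" by (cases "pseudo_divmod x d")
    \<comment> \<open>Since \<open>d\<close> is monic, the scaling factor of pseudo-division is
      1.\<close>
    from pseudo_divmod[OF \<open>d \<noteq> 0\<close> this] d(2)
    have x: "x = d * q + r" and r: "r = 0 \<or> degree r < degree d" by simp_all
    have "r = x + (- q) * d" using x by simp
    then have "r \<in> K" using K(1)[OF \<open>x \<in> K\<close> K(2)[OF d(1), of "- q"]] by (simp only:)
    \<comment> \<open>Otherwise \<open>r\<close> would yield a monic element of \<open>K\<close> of
      degree below that of \<open>d\<close>.\<close>
    with r monic[of r] min have "[:m:] dvd r" by (metis dvd_0_right leD le_trans)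
    then have "x =m d * q" by (simp add: eq_m_iff_dvd x)
    then show "d dvdm x" unfolding dvdm_def by blast
  qed
qed

lemma (in poly_mod) irreducible_m_dvdm_multD:
  assumes "prime m" "irreducible_m g" "g dvdm a * b"
  shows "g dvdm a \<or> g dvdm b"
proof -
  txt \<open>The ideal quotient of \<open>\<langle>m, g\<rangle>\<close> by \<open>b\<close>; its generator modulo \<open>m\<close> divides both \<open>g\<close> and \<open>a\<close>.\<close>
  define K where "K = {x. g dvdm x * b}"
  have "ideal K Zx"
  proof (rule ideal_ring_of_type_algebraI)
    show "0 \<in> K" by (auto simp: K_def dvdm_def intro: exI[of _ 0])
  next
    fix x y assume "x \<in> K" "y \<in> K"
    then show "x + y \<in> K" by (simp add: K_def distrib_right dvdm_add)
  next
    fix x r assume "x \<in> K"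
    then show "r * x \<in> K"
      using dvdm_factor[of g "x * b" r] by (simp add: K_def mult_ac)
  qed
  moreover have "g \<in> K" by (auto simp: K_def intro: dvd_imp_dvdm)
  moreover have "[:m:] * b =m g * 0" by (simp add: eq_m_iff_dvd)
  then have "[:m:] \<in> K" unfolding K_def dvdm_def by blast
  ultimately obtain d where d: "d \<in> K" "\<And>x. x \<in> K \<Longrightarrow> d dvdm x"
    using ideal_principal_mod_prime[OF assms(1), of K] by metis
  have "a \<in> K" using assms(3) by (simp add: K_def)
  then obtain h where h: "a =m d * h" using d(2) by (auto simp: dvdm_def)
  obtain q where q: "g =m d * q" using d(2)[OF \<open>g \<in> K\<close>] by (auto simp: dvdm_def)
  with assms(2) have "d dvdm 1 \<or> q dvdm 1" by (auto simp: irreducible_m_def)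
  then show ?thesis
  proof
    \<comment> \<open>Multiplying \<open>d * b\<close> by an inverse \<open>e\<close> of
      \<open>d\<close> recovers \<open>b\<close>.\<close>
    assume "d dvdm 1"
    then obtain e where e: "1 =m d * e" by (auto simp: dvdm_def)
    have "g dvdm d * b" using d(1) by (simp add: K_def)
    then have "g dvdm d * b * e" using dvdm_factor[of g "d * b" e] by (simp add: mult_ac)
    moreover have "d * b * e =m b" by (metis e mult_Mp(1) mult.assoc mult.commute mult_1)
    ultimately have "g dvdm b" by (metis dvdm_Mp)
    then show ?thesis ..
  \<comment> \<open>Now \<open>g\<close> and \<open>d\<close> are associates modulo
    \<open>m\<close>, and \<open>d\<close> divides \<open>a\<close>.\<close>
  next
    assume "q dvdm 1"
    then obtain e where e: "1 =m q * e" by (auto simp: dvdm_def)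
    have "g * e =m d * (q * e)" by (metis q mult_Mp(1) mult.assoc)
    also have "d * (q * e) =m d" by (metis e mult_Mp(2) mult_1_right)
    finally have "a =m g * (e * h)" by (metis h mult_Mp(1) mult.assoc)
    then show ?thesis unfolding dvdm_def by blast
  qed
qed

lemma (in poly_mod) irreducible_m_dvdm_power:
  assumes "prime m" "irreducible_m g" "g dvdm a ^ n"
  shows "g dvdm a"
  using assms(3)
proof (induction n)
  case 0
  with assms(2) show ?case by (simp add: irreducible_m_def)
next
  case (Suc n)
  with irreducible_m_dvdm_multD[OF assms(1,2)] show ?case by auto
qed

section \<open>Cancelling the prime in the square of the ideal\<close>

text \<open>The term \<open>b * h ^ 2\<close> already lies in the square of \<open>I\<close>, so
  only \<open>a * [:c:]\<close> matters. Allowing any \<open>h\<close> in the ideal covers both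
  \<open>g\<close> and its image under the substitution.\<close>

lemma const_mult_mem_Idl_square_iff:
  fixes c :: int and a g h b :: "int poly"
  assumes "prime c" "\<not> [:c:] dvd g" and h: "h \<in> Idl\<^bsub>Zx\<^esub> {[:c:], g}"
  defines "I \<equiv> Idl\<^bsub>Zx\<^esub> {[:c:], g}"
  shows "a * [:c:] + b * h ^ 2 \<in> I \<cdot>\<^bsub>Zx\<^esub> I \<longleftrightarrow> a \<in> I"
proof -
  define q where "q = [:c:]"
  have q: "prime_elem q"
    using assms(1) unfolding q_def by (intro lift_prime_elem_poly prime_imp_prime_elem)
  have I: "I = {u * q + v * g | u v. True}"
    unfolding I_def q_def Idl_pair ..
  have I2: "I \<cdot>\<^bsub>Zx\<^esub> I = {u * q * q + v * q * g + w * g * g | u v w. True}"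
    unfolding I_def q_def Idl_pair_square ..
  from h obtain r s where "h = r * q + s * g" unfolding I_def[symmetric] I by blast
  then have h2: "b * h ^ 2 = b * r * r * q * q + 2 * b * r * s * q * g + b * s * s * g * g"
    by (simp add: algebra_simps power2_eq_square)
  show ?thesis unfolding q_def[symmetric]
  proof
    assume "a \<in> I"
    then obtain u v where "a = u * q + v * g" unfolding I by blast
    then have "a * q + b * h ^ 2 =
        (u + b * r * r) * q * q + (v + 2 * b * r * s) * q * g + (b * s * s) * g * g"
      unfolding h2 by (simp add: algebra_simps)
    then show "a * q + b * h ^ 2 \<in> I \<cdot>\<^bsub>Zx\<^esub> I" unfolding I2 by blast
  next
    assume "a * q + b * h ^ 2 \<in> I \<cdot>\<^bsub>Zx\<^esub> I"
    then obtain u v w where "a * q + b * h ^ 2 = u * q * q + v * q * g + w * g * g"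
      unfolding I2 by blast
    then have eq: "q * (a - (u - b * r * r) * q - (v - 2 * b * r * s) * g) =
        (w - b * s * s) * (g * g)"
      unfolding h2 by (simp add: algebra_simps)
    then have "q dvd (w - b * s * s) * (g * g)" by (metis dvd_triv_left)
    \<comment> \<open>The prime \<open>q\<close> does not divide \<open>g\<close>, so it divides the
      other factor; then \<open>q\<close> cancels from \<open>eq\<close>.\<close>
    then have "q dvd w - b * s * s"
      using q assms(2) by (auto simp: prime_elem_dvd_mult_iff q_def)
    then obtain t where "w - b * s * s = q * t" by (rule dvdE)
    with eq have "q * (a - (u - b * r * r) * q - (v - 2 * b * r * s) * g) = q * (t * g * g)"
      by (simp add: mult.assoc)
    then have "a - (u - b * r * r) * q - (v - 2 * b * r * s) * g = t * g * g"
      using q by (simp add: prime_elem_def)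
    then have "a = (u - b * r * r) * q + (v - 2 * b * r * s + t * g) * g"
      by (simp add: algebra_simps)
    then show "a \<in> I" unfolding I by blast
  qed
qed

theorem theorem2p4:
  fixes f g :: "int poly" and p :: nat
  assumes "lead_coeff f = 1"
    and "lead_coeff g = 1"
    and "prime p"
    and "poly_mod.irreducible_m (int p) g"
    and "f \<in> Idl\<^bsub>Zx\<^esub> {[:int p:], g ^ 2}"
  shows "f \<in> (Idl\<^bsub>Zx\<^esub> {[:int p:], g}) \<cdot>\<^bsub>Zx\<^esub> (Idl\<^bsub>Zx\<^esub> {[:int p:], g})
    \<longleftrightarrow> pcompose f (monom 1 p) \<in> (Idl\<^bsub>Zx\<^esub> {[:int p:], g}) \<cdot>\<^bsub>Zx\<^esub> (Idl\<^bsub>Zx\<^esub> {[:int p:], g})"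
proof -
  interpret poly_mod "int p" .
  have prime_p: "prime (int p)" using assms(3) by simp
  define \<phi> where "\<phi> h = pcompose h (monom 1 p)" for h :: "int poly"
  obtain a b where f: "f = a * [:int p:] + b * g ^ 2"
    using assms(5) by (auto simp: Idl_pair)
  \<comment> \<open>Substitution is a ring homomorphism fixing integer constants.\<close>
  have \<phi>f: "\<phi> f = \<phi> a * [:int p:] + \<phi> b * \<phi> g ^ 2"
    by (simp add: \<phi>_def f pcompose_add pcompose_mult pcompose_smult pcompose_hom.hom_power
        power2_eq_square)
  have frob: "\<phi> h =m h ^ p" for h
    using prime_dvd_pcompose_monom_diff[OF assms(3), of h]
    by (simp add: eq_m_iff_dvd \<phi>_def of_nat_poly)
  have "g dvdm g ^ p"
    using assms(3) by (intro dvd_imp_dvdm dvd_power) (simp add: prime_gt_0_nat)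
  then have \<phi>g: "g dvdm \<phi> g" by (metis frob dvdm_Mp)
  have "g dvdm a \<longleftrightarrow> g dvdm a ^ p"
  proof
    assume "g dvdm a"
    then show "g dvdm a ^ p"
      using assms(3) by (metis dvdm_factor power_eq_if prime_gt_0_nat less_numeral_extra(3))
  qed (rule irreducible_m_dvdm_power[OF prime_p assms(4)])
  also have "\<dots> \<longleftrightarrow> g dvdm \<phi> a" by (metis frob dvdm_Mp)
  finally have a: "g dvdm a \<longleftrightarrow> g dvdm \<phi> a" .
  \<comment> \<open>Irreducibility modulo \<open>p\<close> excludes the zero polynomial.\<close>
  have "\<not> [:int p:] dvd g"
    using assms(4) eq_m_iff_dvd[of g 0] by (auto simp: irreducible_m_def)
  note * = const_mult_mem_Idl_square_iff[OF prime_p this, folded dvdm_iff_mem_Idl]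
  have "g dvdm g" by (intro dvd_imp_dvdm) simp
  then show ?thesis
    using *[of g a b] *[of "\<phi> g" "\<phi> a" "\<phi> b"] \<phi>g a
    unfolding \<phi>_def[symmetric] \<phi>f f[symmetric] by simp
qed

end
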